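(* Let $m\ge1$, let $c,d\in\mathbb{R}$ with $c\ne0$, let $\varepsilon_1,\dots,\varepsilon_m\in\{1,-1\}$, and let $J$ be the complex structure on $\mathfrak{gh}_{2m+2}$ with $$J(T-dZ)=cZ,\quad J(cZ)=-(T-dZ),\quad JX_i=\varepsilon_iY_i,\quad JY_i=-\varepsilon_iX_i.$$ Let $\psi=\sum_{i=1}^m a_ix_i+\sum_{j=1}^m b_jy_j+c_0z$ with $a_i,b_j,c_0\in\mathbb{R}$, let $\omega_\psi=\psi\wedge t+\mathrm{d}\psi$ and $\langle U,V\rangle_\psi=\omega_\psi(JU,V)$. Then $\langle\cdot,\cdot\rangle_\psi$ defines, together with $J$, a (positive definite) lcK metric on $\mathfrak{gh}_{2m+2}$ if and only if $cc_0>0$ and $a_i=b_i=0$, $\mathrm{sgn}(c_0)\varepsilon_i=1$ for $i=1,\dots,m$; and it is then always of Vaisman type. More generally, $\langle\cdot,\cdot\rangle_\psi$ is a locally conformally pseudo-Kähler metric if and only if $c_0\ne0$ and $a_i=b_i=0$ for $i=1,\dots,m$; again it is then of Vaisman type.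
   Context: $\mathfrak{gh}_{2m+2}=\mathbb{R}\oplus\mathfrak h_{2m+1}$ ($\mathfrak h_{2m+1}$ the Heisenberg Lie algebra of dimension $2m+1$) has a standard basis $\{T,X_i,Y_i,Z\mid i=1,\dots,m\}$ whose only non-zero Lie brackets are $[X_i,Y_i]=Z$ (up to skew-symmetry); $t,x_i,y_i,z$ denotes the dual basis, and $\mathrm{d}$ the Chevalley–Eilenberg differential, so $\mathrm{d}t=\mathrm{d}x_i=\mathrm{d}y_i=0$, $\mathrm{d}z=\sum_i y_i\wedge x_i$. A Hermitian structure on a Lie algebra $\mathfrak g$ is a pair $(\langle\cdot,\cdot\rangle,J)$ of a (positive definite) scalar product and a skew-symmetric $J$ with $J^2=-\mathrm{Id}$ and vanishing Nijenhuis tensor; its fundamental form is $\omega=\langle\cdot,J\cdot\rangle$. It is locally conformally Kähler (lcK) if $\mathrm{d}\omega=\omega\wedge\theta$ for a closed $1$-form $\theta\in\mathfrak g^*$ (the Lee form). It is called locally conformally pseudo-Kähler if the same holds with $\langle\cdot,\cdot\rangle$ allowed to be an indefinite (nondegenerate symmetric) scalar product. In either case it is called Vaisman if $\nabla\theta=0$, where $\nabla$ is the Levi-Civita connection of $\langle\cdot,\cdot\rangle$. *)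

theory Defs
  imports "HOL-Analysis.Analysis"
begin

section \<open>Lie algebras and left-invariant forms\<close>

text \<open>
  A Lie algebra is a real vector space type together with a bracket on it.
  A \<open>k\<close>-form is a \<open>k\<close>-linear alternating curried real-valued function; only
  degrees one to three occur, so the wedge product and the Chevalley--Eilenberg differential
  are given in the degrees needed. The wedge product carries no factorial normalisation:
  \<open>(\<alpha> \<and> \<beta>)(u, v) = \<alpha>(u) \<beta>(v) - \<alpha>(v) \<beta>(u)\<close>.
\<close>

definition lie_algebra :: "('a::real_vector \<Rightarrow> 'a \<Rightarrow> 'a) \<Rightarrow> bool" where
  "lie_algebra br \<longleftrightarrow> bilinear br \<and> (\<forall>u. br u u = 0) \<and>
     (\<forall>u v w. br u (br v w) + br v (br w u) + br w (br u v) = 0)"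

definition wedge11 :: "('a \<Rightarrow> real) \<Rightarrow> ('a \<Rightarrow> real) \<Rightarrow> 'a \<Rightarrow> 'a \<Rightarrow> real" where
  "wedge11 \<alpha> \<beta> u v = \<alpha> u * \<beta> v - \<alpha> v * \<beta> u"

definition wedge21 :: "('a \<Rightarrow> 'a \<Rightarrow> real) \<Rightarrow> ('a \<Rightarrow> real) \<Rightarrow> 'a \<Rightarrow> 'a \<Rightarrow> 'a \<Rightarrow> real" where
  "wedge21 \<omega> \<theta> u v w = \<omega> u v * \<theta> w - \<omega> u w * \<theta> v + \<omega> v w * \<theta> u"

definition ce_d1 :: "('a \<Rightarrow> 'a \<Rightarrow> 'a) \<Rightarrow> ('a \<Rightarrow> real) \<Rightarrow> 'a \<Rightarrow> 'a \<Rightarrow> real" where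
  "ce_d1 br \<alpha> u v = - \<alpha> (br u v)"

definition ce_d2 :: "('a \<Rightarrow> 'a \<Rightarrow> 'a) \<Rightarrow> ('a \<Rightarrow> 'a \<Rightarrow> real) \<Rightarrow> 'a \<Rightarrow> 'a \<Rightarrow> 'a \<Rightarrow> real" where
  "ce_d2 br \<omega> u v w = - \<omega> (br u v) w + \<omega> (br u w) v - \<omega> (br v w) u"


section \<open>Pseudo-Hermitian structures\<close>

definition scalar_product :: "('a::real_vector \<Rightarrow> 'a \<Rightarrow> real) \<Rightarrow> bool" where
  "scalar_product g \<longleftrightarrow> bilinear g \<and> (\<forall>u v. g u v = g v u) \<and>
     (\<forall>u. (\<forall>v. g u v = 0) \<longrightarrow> u = 0)"

definition positive_definite :: "('a::real_vector \<Rightarrow> 'a \<Rightarrow> real) \<Rightarrow> bool" where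
  "positive_definite g \<longleftrightarrow> (\<forall>u. u \<noteq> 0 \<longrightarrow> g u u > 0)"

definition nijenhuis ::
  "('a::real_vector \<Rightarrow> 'a \<Rightarrow> 'a) \<Rightarrow> ('a \<Rightarrow> 'a) \<Rightarrow> 'a \<Rightarrow> 'a \<Rightarrow> 'a" where
  "nijenhuis br J u v = br (J u) (J v) - J (br (J u) v) - J (br u (J v)) - br u v"

definition complex_structure ::
  "('a::real_vector \<Rightarrow> 'a \<Rightarrow> 'a) \<Rightarrow> ('a \<Rightarrow> 'a) \<Rightarrow> bool" where
  "complex_structure br J \<longleftrightarrow>
     linear J \<and> (\<forall>u. J (J u) = - u) \<and> (\<forall>u v. nijenhuis br J u v = 0)"

definition pseudo_hermitian ::
  "('a::real_vector \<Rightarrow> 'a \<Rightarrow> 'a) \<Rightarrow> ('a \<Rightarrow> 'a \<Rightarrow> real) \<Rightarrow> ('a \<Rightarrow> 'a) \<Rightarrow> bool" where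
  "pseudo_hermitian br g J \<longleftrightarrow> scalar_product g \<and> complex_structure br J \<and>
     (\<forall>u v. g (J u) v = - g u (J v))"

definition fundamental_form ::
  "('a \<Rightarrow> 'a \<Rightarrow> real) \<Rightarrow> ('a \<Rightarrow> 'a) \<Rightarrow> 'a \<Rightarrow> 'a \<Rightarrow> real" where
  "fundamental_form g J u v = g u (J v)"

definition lee_form ::
  "('a::real_vector \<Rightarrow> 'a \<Rightarrow> 'a) \<Rightarrow> ('a \<Rightarrow> 'a \<Rightarrow> real) \<Rightarrow> ('a \<Rightarrow> 'a) \<Rightarrow> ('a \<Rightarrow> real) \<Rightarrow> bool" where
  "lee_form br g J \<theta> \<longleftrightarrow> linear \<theta> \<and> (\<forall>u v. ce_d1 br \<theta> u v = 0) \<and>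
     ce_d2 br (fundamental_form g J) = wedge21 (fundamental_form g J) \<theta>"

definition loc_conf_pseudo_kaehler ::
  "('a::real_vector \<Rightarrow> 'a \<Rightarrow> 'a) \<Rightarrow> ('a \<Rightarrow> 'a \<Rightarrow> real) \<Rightarrow> ('a \<Rightarrow> 'a) \<Rightarrow> bool" where
  "loc_conf_pseudo_kaehler br g J \<longleftrightarrow> pseudo_hermitian br g J \<and> (\<exists>\<theta>. lee_form br g J \<theta>)"

definition loc_conf_kaehler ::
  "('a::real_vector \<Rightarrow> 'a \<Rightarrow> 'a) \<Rightarrow> ('a \<Rightarrow> 'a \<Rightarrow> real) \<Rightarrow> ('a \<Rightarrow> 'a) \<Rightarrow> bool" where
  "loc_conf_kaehler br g J \<longleftrightarrow> positive_definite g \<and> loc_conf_pseudo_kaehler br g J"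


section \<open>Levi-Civita connection and Vaisman structures\<close>

text \<open>
  \<open>nab u v\<close> is the covariant derivative of \<open>v\<close> in direction \<open>u\<close>; for left-invariant fields,
  metric compatibility means that each \<open>nab u\<close> is skew-symmetric.
\<close>

definition levi_civita ::
  "('a::real_vector \<Rightarrow> 'a \<Rightarrow> 'a) \<Rightarrow> ('a \<Rightarrow> 'a \<Rightarrow> real) \<Rightarrow> ('a \<Rightarrow> 'a \<Rightarrow> 'a) \<Rightarrow> bool" where
  "levi_civita br g nab \<longleftrightarrow> bilinear nab \<and>
     (\<forall>u v. nab u v - nab v u = br u v) \<and>
     (\<forall>u v w. g (nab u v) w + g v (nab u w) = 0)"

lemma levi_civita_unique:
  assumes g: "scalar_product g" and 1: "levi_civita br g nab1" and 2: "levi_civita br g nab2"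
  shows "nab1 = nab2"
proof (intro ext)
  fix u v
  define D where "D u v = nab1 u v - nab2 u v" for u v
  have bil: "bilinear g" and sym: "\<And>u v. g u v = g v u"
    and nondeg: "\<And>u. (\<And>v. g u v = 0) \<Longrightarrow> u = 0"
    using g unfolding scalar_product_def by blast+
  have D_sym: "D u v = D v u" for u v
  proof -
    have "nab1 u v - nab1 v u = nab2 u v - nab2 v u"
      using 1 2 unfolding levi_civita_def by metis
    then show ?thesis unfolding D_def by (simp add: algebra_simps)
  qed
  have D_skew: "g (D u v) w = - g (D u w) v" for u v w
  proof -
    have "g (nab1 u v) w + g v (nab1 u w) = 0" "g (nab2 u v) w + g v (nab2 u w) = 0"
      using 1 2 unfolding levi_civita_def by blast+
    then show ?thesis
      unfolding D_def bilinear_lsub[OF bil] by (simp add: sym[of v])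
  qed
  have "g (D u v) w = 0" for w
  proof -
    have "g (D u v) w = - g (D u w) v" by (rule D_skew)
    also have "\<dots> = - g (D w u) v" by (simp add: D_sym[of u])
    also have "\<dots> = g (D w v) u" by (simp add: D_skew[of w u])
    also have "\<dots> = g (D v w) u" by (simp add: D_sym[of w])
    also have "\<dots> = - g (D v u) w" by (rule D_skew)
    also have "\<dots> = - g (D u v) w" by (simp add: D_sym[of v])
    finally show ?thesis by simp
  qed
  then have "D u v = 0" by (rule nondeg)
  then show "nab1 u v = nab2 u v" by (simp add: D_def)
qed

definition cov_deriv_form :: "('a \<Rightarrow> 'a \<Rightarrow> 'a) \<Rightarrow> ('a \<Rightarrow> real) \<Rightarrow> 'a \<Rightarrow> 'a \<Rightarrow> real" where
  "cov_deriv_form nab \<theta> u v = - \<theta> (nab u v)"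

definition vaisman ::
  "('a::real_vector \<Rightarrow> 'a \<Rightarrow> 'a) \<Rightarrow> ('a \<Rightarrow> 'a \<Rightarrow> real) \<Rightarrow> ('a \<Rightarrow> 'a) \<Rightarrow> bool" where
  "vaisman br g J \<longleftrightarrow> loc_conf_pseudo_kaehler br g J \<and>
     (\<exists>\<theta> nab. lee_form br g J \<theta> \<and> levi_civita br g nab \<and>
       (\<forall>u v. cov_deriv_form nab \<theta> u v = 0))"


section \<open>The Lie algebra \<open>\<real> \<oplus> \<hh>\<close>, \<open>\<hh>\<close> the Heisenberg algebra\<close>

text \<open>
  The index set \<open>{1, \<dots>, m}\<close> is a finite type \<open>'m\<close>, so \<open>m = CARD('m) \<ge> 1\<close>.
  A tuple \<open>(t, x, y, z)\<close> stands for \<open>t T + \<Sum>\<^sub>i x\<^sub>i X\<^sub>i + \<Sum>\<^sub>i y\<^sub>i Y\<^sub>i + z Z\<close>.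
\<close>

type_synonym 'm gh = "real \<times> (real ^ 'm) \<times> (real ^ 'm) \<times> real"

definition gh_T :: "'m::finite gh" where "gh_T = (1, 0, 0, 0)"
definition gh_X :: "'m::finite \<Rightarrow> 'm gh" where "gh_X i = (0, axis i 1, 0, 0)"
definition gh_Y :: "'m::finite \<Rightarrow> 'm gh" where "gh_Y i = (0, 0, axis i 1, 0)"
definition gh_Z :: "'m::finite gh" where "gh_Z = (0, 0, 0, 1)"

definition gh_t :: "'m::finite gh \<Rightarrow> real" where "gh_t = (\<lambda>(t, x, y, z). t)"
definition gh_x :: "'m::finite \<Rightarrow> 'm gh \<Rightarrow> real" where "gh_x i = (\<lambda>(t, x, y, z). x $ i)"
definition gh_y :: "'m::finite \<Rightarrow> 'm gh \<Rightarrow> real" where "gh_y i = (\<lambda>(t, x, y, z). y $ i)"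
definition gh_z :: "'m::finite gh \<Rightarrow> real" where "gh_z = (\<lambda>(t, x, y, z). z)"

definition gh_bracket :: "'m::finite gh \<Rightarrow> 'm gh \<Rightarrow> 'm gh" where
  "gh_bracket U V = (\<Sum>i\<in>UNIV. gh_x i U * gh_y i V - gh_y i U * gh_x i V) *\<^sub>R gh_Z"

lemmas gh_defs = gh_T_def gh_X_def gh_Y_def gh_Z_def gh_t_def gh_x_def gh_y_def gh_z_def

lemma gh_basis_expansion:
  "U = gh_t U *\<^sub>R gh_T + (\<Sum>i\<in>UNIV. gh_x i U *\<^sub>R gh_X i) + (\<Sum>i\<in>UNIV. gh_y i U *\<^sub>R gh_Y i)
       + gh_z U *\<^sub>R gh_Z"
  by (auto simp: gh_defs prod_eq_iff fst_sum snd_sum vec_eq_iff axis_def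
        if_distrib[where f = "\<lambda>x. _ * x"] sum.delta' split: prod.splits cong: if_cong)

lemma gh_bracket_basis:
  "gh_bracket (gh_X i) (gh_Y j) = (if i = j then gh_Z else 0)"
  "gh_bracket (gh_Y j) (gh_X i) = (if i = j then - gh_Z else 0)"
  "gh_bracket (gh_X i) (gh_X j) = 0"
  "gh_bracket (gh_Y i) (gh_Y j) = 0"
  "gh_bracket gh_T U = 0" "gh_bracket U gh_T = 0"
  "gh_bracket gh_Z U = 0" "gh_bracket U gh_Z = 0"
  by (auto simp: gh_bracket_def gh_defs zero_prod_def axis_def sum_negf sum.delta sum.delta'
        if_distrib[where f = "\<lambda>x. _ * x"] if_distrib[where f = "\<lambda>x. x * _"]
        split: prod.splits cong: if_cong)

lemma lie_algebra_gh_bracket: "lie_algebra (gh_bracket :: 'm::finite gh \<Rightarrow> _)"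
proof -
  have "bilinear (gh_bracket :: 'm gh \<Rightarrow> _)"
    unfolding bilinear_def
    by (auto intro!: linearI
        simp: gh_bracket_def gh_x_def gh_y_def gh_Z_def split_beta algebra_simps sum.distrib
          sum_subtractf sum_distrib_left)
  moreover have "gh_bracket u u = 0" for u :: "'m gh"
    by (simp add: gh_bracket_def mult.commute)
  moreover have "gh_bracket u (gh_bracket v w) = 0" for u v w :: "'m gh"
    by (simp add: gh_bracket_def[of u] gh_bracket_def[of v] gh_x_def gh_y_def gh_Z_def
        zero_prod_def)
  ultimately show ?thesis unfolding lie_algebra_def by simp
qed

lemma ce_d1_gh_z: "ce_d1 gh_bracket gh_z U V = (\<Sum>i\<in>UNIV. wedge11 (gh_y i) (gh_x i) U V)"
  by (simp add: ce_d1_def gh_bracket_def wedge11_def gh_z_def gh_Z_def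
        sum_negf[symmetric] algebra_simps)

lemma gh_complex_structure_exists:
  fixes c d :: real and \<epsilon> :: "'m::finite \<Rightarrow> real"
  assumes "c \<noteq> 0"
  shows "\<exists>J :: 'm gh \<Rightarrow> 'm gh. linear J \<and>
           J (gh_T - d *\<^sub>R gh_Z) = c *\<^sub>R gh_Z \<and>
           J (c *\<^sub>R gh_Z) = - (gh_T - d *\<^sub>R gh_Z) \<and>
           (\<forall>i. J (gh_X i) = \<epsilon> i *\<^sub>R gh_Y i) \<and>
           (\<forall>i. J (gh_Y i) = - (\<epsilon> i *\<^sub>R gh_X i))"
proof -
  define J :: "'m gh \<Rightarrow> 'm gh" where
    "J = (\<lambda>(t, x, y, z). (- (inverse c * (z + d * t)), - (\<chi> i. \<epsilon> i * y $ i), (\<chi> i. \<epsilon> i * x $ i),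
                          c * t + d * (inverse c * (z + d * t))))"
  have "linear J"
    by (rule linearI)
      (auto simp: J_def vec_eq_iff algebra_simps)
  then show ?thesis
    using assms
    by (intro exI[of _ J]) (auto simp: J_def gh_defs vec_eq_iff axis_def zero_prod_def)
qed


section \<open>The forms \<open>\<omega>\<^sub>\<psi>\<close> and \<open>\<langle>\<cdot>,\<cdot>\<rangle>\<^sub>\<psi>\<close>\<close>

definition gh_psi :: "('m::finite \<Rightarrow> real) \<Rightarrow> ('m \<Rightarrow> real) \<Rightarrow> real \<Rightarrow> 'm gh \<Rightarrow> real" where
  "gh_psi a b c0 U = (\<Sum>i\<in>UNIV. a i * gh_x i U) + (\<Sum>j\<in>UNIV. b j * gh_y j U) + c0 * gh_z U"

definition gh_omega :: "('m::finite gh \<Rightarrow> real) \<Rightarrow> 'm gh \<Rightarrow> 'm gh \<Rightarrow> real" where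
  "gh_omega \<psi> U V = wedge11 \<psi> gh_t U V + ce_d1 gh_bracket \<psi> U V"

definition gh_metric ::
  "('m::finite gh \<Rightarrow> 'm gh) \<Rightarrow> ('m gh \<Rightarrow> real) \<Rightarrow> 'm gh \<Rightarrow> 'm gh \<Rightarrow> real" where
  "gh_metric J \<psi> U V = gh_omega \<psi> (J U) V"

end

theory Submission
  imports Defs
begin

text \<open>
  Write \<open>s = z + d t\<close> and \<open>\<beta>(U, V) = \<Sum>\<^sub>i (x\<^sub>i(U) y\<^sub>i(V) - y\<^sub>i(U) x\<^sub>i(V))\<close>, so that \<open>[U, V] = \<beta>(U, V) Z\<close>.

  Symmetry of the form forces the vanishing of the coefficients: comparing
  \<open>\<langle>Z, X\<^sub>i\<rangle> = a\<^sub>i / c\<close> with \<open>\<langle>X\<^sub>i, Z\<rangle> = 0\<close>, and likewise for \<open>Y\<^sub>i\<close>, gives \<open>a\<^sub>i = b\<^sub>i = 0\<close>,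
  after which the form is \<open>c\<^sub>0\<close> times \<open>c t t' + s s' / c + \<Sum>\<^sub>i \<epsilon>\<^sub>i (x\<^sub>i x\<^sub>i' + y\<^sub>i y\<^sub>i')\<close>
  (lemma \<open>gh_metric_gh_J\<close>). This is diagonal in the basis \<open>T - d Z, X\<^sub>i, Y\<^sub>i, Z\<close>, so it is
  nondegenerate iff \<open>c\<^sub>0 \<noteq> 0\<close>, and its signature is read off from the signs of \<open>c c\<^sub>0\<close> and
  \<open>c\<^sub>0 \<epsilon>\<^sub>i\<close>.

  Conversely, let \<open>a\<^sub>i = b\<^sub>i = 0\<close> and \<open>c\<^sub>0 \<noteq> 0\<close>. Then \<open>\<omega> = c\<^sub>0 (z \<and> t + dz)\<close> satisfies
  \<open>d\<omega> = \<omega> \<and> t\<close>, so \<open>t\<close> is a Lee form. Its metric dual is a multiple of the central vector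
  \<open>T - d Z\<close>, which is therefore Killing; as \<open>t\<close> is also closed, it is parallel. Concretely, the
  Koszul formula gives an explicit Levi-Civita connection (\<open>gh_nabla\<close>) whose values have no
  \<open>T\<close>-component.
\<close>

section \<open>The bracket and the complex structure in coordinates\<close>

text \<open>The two-form \<open>\<beta> = -dz\<close>, through which the bracket is \<open>[U, V] = \<beta>(U, V) Z\<close>.\<close>

definition gh_beta :: "'m::finite gh \<Rightarrow> 'm gh \<Rightarrow> real" where
  "gh_beta U V = (\<Sum>i\<in>UNIV. gh_x i U * gh_y i V - gh_y i U * gh_x i V)"

text \<open>The linear form \<open>s = z + d t\<close>, which vanishes on \<open>T - d Z\<close>.\<close>

definition gh_s :: "real \<Rightarrow> 'm::finite gh \<Rightarrow> real" where
  "gh_s d U = gh_z U + d * gh_t U"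

text \<open>The endomorphism prescribed by \<open>T - d Z \<mapsto> c Z \<mapsto> -(T - d Z)\<close> and
  \<open>X\<^sub>i \<mapsto> \<epsilon>\<^sub>i Y\<^sub>i\<close>, \<open>Y\<^sub>i \<mapsto> -\<epsilon>\<^sub>i X\<^sub>i\<close>, in coordinates.\<close>

definition gh_J :: "real \<Rightarrow> real \<Rightarrow> ('m::finite \<Rightarrow> real) \<Rightarrow> 'm gh \<Rightarrow> 'm gh" where
  "gh_J c d \<epsilon> U = (- (gh_s d U / c), (\<chi> i. - (\<epsilon> i * gh_y i U)), (\<chi> i. \<epsilon> i * gh_x i U),
                   c * gh_t U + d * (gh_s d U / c))"

lemma gh_coord_simps [simp]:
  "gh_t (t, x, y, z) = t" "gh_x i (t, x, y, z) = x $ i"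
  "gh_y i (t, x, y, z) = y $ i" "gh_z (t, x, y, z) = z"
  by (simp_all add: gh_defs)

lemma gh_coord_linear:
  "linear gh_t" "linear (gh_x i)" "linear (gh_y i)" "linear gh_z" "linear (gh_s d)"
  by (auto intro!: linearI simp: gh_defs gh_s_def split_beta algebra_simps)

lemmas gh_coord_lin_simps =
  gh_coord_linear[THEN linear_add] gh_coord_linear[THEN linear_diff]
  gh_coord_linear[THEN linear_cmul] gh_coord_linear[THEN linear_0]
  gh_coord_linear[THEN linear_neg]

lemma gh_eqI:
  assumes "gh_t U = gh_t V" "\<And>i. gh_x i U = gh_x i V" "\<And>i. gh_y i U = gh_y i V" "gh_z U = gh_z V"
  shows "U = V"
  using assms by (cases U; cases V) (simp add: vec_eq_iff)

lemma gh_J_coords [simp]: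
  "gh_t (gh_J c d \<epsilon> U) = - (gh_s d U / c)"
  "gh_x i (gh_J c d \<epsilon> U) = - (\<epsilon> i * gh_y i U)"
  "gh_y i (gh_J c d \<epsilon> U) = \<epsilon> i * gh_x i U"
  "gh_z (gh_J c d \<epsilon> U) = c * gh_t U + d * (gh_s d U / c)"
  "gh_s d (gh_J c d \<epsilon> U) = c * gh_t U"
  by (simp_all add: gh_J_def gh_s_def)

lemma linear_gh_J: "linear (gh_J c d \<epsilon>)"
  by (rule linearI; rule gh_eqI) (simp_all add: gh_coord_lin_simps field_simps add_divide_distrib)

lemma gh_bracket_coords [simp]:
  "gh_t (gh_bracket U V) = 0" "gh_x i (gh_bracket U V) = 0" "gh_y i (gh_bracket U V) = 0"
  "gh_z (gh_bracket U V) = gh_beta U V" "gh_s d (gh_bracket U V) = gh_beta U V"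
  by (simp_all add: gh_bracket_def gh_beta_def gh_Z_def gh_s_def)

lemma gh_J_unique:
  fixes J :: "'m::finite gh \<Rightarrow> 'm gh"
  assumes c: "c \<noteq> 0" and lin: "linear J"
    and JT: "J (gh_T - d *\<^sub>R gh_Z) = c *\<^sub>R gh_Z"
    and JZ: "J (c *\<^sub>R gh_Z) = - (gh_T - d *\<^sub>R gh_Z)"
    and JX: "\<And>i. J (gh_X i) = \<epsilon> i *\<^sub>R gh_Y i"
    and JY: "\<And>i. J (gh_Y i) = - (\<epsilon> i *\<^sub>R gh_X i)"
  shows "J = gh_J c d \<epsilon>"
proof
  have J0T: "gh_J c d \<epsilon> (gh_T - d *\<^sub>R gh_Z) = c *\<^sub>R gh_Z"
    and J0Z: "gh_J c d \<epsilon> (c *\<^sub>R gh_Z) = - (gh_T - d *\<^sub>R gh_Z)"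
    and J0X: "\<And>i. gh_J c d \<epsilon> (gh_X i) = \<epsilon> i *\<^sub>R gh_Y i"
    and J0Y: "\<And>i. gh_J c d \<epsilon> (gh_Y i) = - (\<epsilon> i *\<^sub>R gh_X i)"
    using c by (auto simp: gh_J_def gh_s_def gh_defs axis_def vec_eq_iff)
  have Z: "J gh_Z = gh_J c d \<epsilon> gh_Z"
  proof -
    have "c *\<^sub>R J gh_Z = c *\<^sub>R gh_J c d \<epsilon> gh_Z"
      using JZ J0Z linear_cmul[OF lin] linear_cmul[OF linear_gh_J] by metis
    then show ?thesis using c by simp
  qed
  have T: "J gh_T = gh_J c d \<epsilon> gh_T"
  proof -
    have "J gh_T - d *\<^sub>R J gh_Z = gh_J c d \<epsilon> gh_T - d *\<^sub>R gh_J c d \<epsilon> gh_Z"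
      using JT J0T
      by (simp add: linear_diff[OF lin] linear_cmul[OF lin] linear_diff[OF linear_gh_J]
          linear_cmul[OF linear_gh_J])
    then show ?thesis by (simp add: Z)
  qed
  fix U
  have expand: "f U = gh_t U *\<^sub>R f gh_T + (\<Sum>i\<in>UNIV. gh_x i U *\<^sub>R f (gh_X i))
          + (\<Sum>i\<in>UNIV. gh_y i U *\<^sub>R f (gh_Y i)) + gh_z U *\<^sub>R f gh_Z"
    if "linear f" for f :: "'m gh \<Rightarrow> 'm gh"
  proof -
    have "f U = f (gh_t U *\<^sub>R gh_T + (\<Sum>i\<in>UNIV. gh_x i U *\<^sub>R gh_X i)
          + (\<Sum>i\<in>UNIV. gh_y i U *\<^sub>R gh_Y i) + gh_z U *\<^sub>R gh_Z)"
      by (rule arg_cong[OF gh_basis_expansion])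
    also have "\<dots> = gh_t U *\<^sub>R f gh_T + (\<Sum>i\<in>UNIV. gh_x i U *\<^sub>R f (gh_X i))
          + (\<Sum>i\<in>UNIV. gh_y i U *\<^sub>R f (gh_Y i)) + gh_z U *\<^sub>R f gh_Z"
      by (simp only: linear_add[OF that] linear_sum[OF that] linear_cmul[OF that])
    finally show ?thesis .
  qed
  show "J U = gh_J c d \<epsilon> U"
    by (simp only: expand[OF lin] expand[OF linear_gh_J] T Z JX JY J0X J0Y)
qed

lemma gh_J_square:
  assumes "c \<noteq> 0" and "\<forall>i. \<epsilon> i \<in> {1, -1}"
  shows "gh_J c d \<epsilon> (gh_J c d \<epsilon> U) = - U"
proof -
  have eps: "\<epsilon> i * (\<epsilon> i * r) = r" for i r using spec[OF assms(2), of i] by auto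
  show ?thesis
    using assms(1)
    by (intro gh_eqI) (simp_all add: gh_coord_lin_simps eps, simp add: gh_s_def)
qed

text \<open>Integrability holds because \<open>\<beta>\<close> is \<open>J\<close>-invariant.\<close>

lemma complex_structure_gh_J:
  assumes "c \<noteq> 0" and "\<forall>i. \<epsilon> i \<in> {1, -1}"
  shows "complex_structure gh_bracket (gh_J c d \<epsilon>)"
proof -
  let ?J = "gh_J c d \<epsilon>"
  have eps: "\<epsilon> i * (\<epsilon> i * r) = r" for i r using spec[OF assms(2), of i] by auto
  have inv: "gh_beta (?J U) (?J V) = gh_beta U V" for U V
    by (simp add: gh_beta_def algebra_simps eps)
  have skew: "gh_beta (?J U) V + gh_beta U (?J V) = 0" for U V
    unfolding gh_beta_def by (simp add: sum.distrib[symmetric] algebra_simps)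
  have "gh_bracket (?J U) V + gh_bracket U (?J V) = 0" for U V
    by (rule gh_eqI) (simp_all add: gh_coord_lin_simps skew)
  then have "?J (gh_bracket (?J U) V) + ?J (gh_bracket U (?J V)) = 0" for U V
    by (metis linear_0 linear_add linear_gh_J)
  moreover have "gh_bracket (?J U) (?J V) = gh_bracket U V" for U V
    by (rule gh_eqI) (simp_all add: inv)
  ultimately have "nijenhuis gh_bracket ?J U V = 0" for U V
    by (simp add: nijenhuis_def diff_diff_eq)
  then show ?thesis
    using assms by (simp add: complex_structure_def linear_gh_J gh_J_square)
qed

section \<open>The metric\<close>

lemma gh_psi_basis [simp]:
  "gh_psi a b c0 (gh_X i) = a i" "gh_psi a b c0 (gh_Y i) = b i"
  by (simp_all add: gh_psi_def gh_defs axis_def if_distrib[where f = "\<lambda>x. _ * x"] sum.delta'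
      cong: if_cong)

lemma linear_gh_psi: "linear (gh_psi a b c0)"
  by (rule linearI)
    (simp_all add: gh_psi_def gh_coord_lin_simps algebra_simps sum.distrib sum_distrib_left)

lemma gh_metric_symmetric_imp_zero:
  fixes a b \<epsilon> :: "'m::finite \<Rightarrow> real"
  assumes c: "c \<noteq> 0"
    and sym: "\<And>U V. gh_metric (gh_J c d \<epsilon>) (gh_psi a b c0) U V
                    = gh_metric (gh_J c d \<epsilon>) (gh_psi a b c0) V U"
  shows "a i = 0" and "b i = 0"
proof -
  let ?g = "gh_metric (gh_J c d \<epsilon>) (gh_psi a b c0)"
  have \<psi>0: "gh_psi a b c0 0 = 0" by (rule linear_0[OF linear_gh_psi])
  have br: "gh_bracket (gh_J c d \<epsilon> gh_Z) U = 0" "gh_bracket U gh_Z = 0" for U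
    by (rule gh_eqI; simp add: gh_beta_def gh_coord_lin_simps; simp add: gh_Z_def)+
  have tXY: "gh_t (gh_X i) = 0" "gh_t (gh_Y i) = 0" by (simp_all add: gh_defs)
  have tZ: "gh_t gh_Z = 0" "gh_s d gh_Z = 1" by (simp_all add: gh_Z_def gh_s_def)
  have tJ: "gh_t (gh_J c d \<epsilon> (gh_X i)) = 0" "gh_t (gh_J c d \<epsilon> (gh_Y i)) = 0"
    by (simp_all add: gh_s_def gh_X_def gh_Y_def)
  have "?g gh_Z (gh_X i) = a i / c" "?g gh_Z (gh_Y i) = b i / c"
    by (simp_all add: gh_metric_def gh_omega_def wedge11_def ce_d1_def br \<psi>0 tXY tZ)
  moreover have "?g (gh_X i) gh_Z = 0" "?g (gh_Y i) gh_Z = 0"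
    using tJ by (simp_all add: gh_metric_def gh_omega_def wedge11_def ce_d1_def br \<psi>0 tZ
        del: gh_J_coords)
  ultimately have "a i / c = 0" "b i / c = 0" using sym by metis+
  then show "a i = 0" "b i = 0" using c by simp_all
qed

lemma gh_psi_central: "gh_psi (\<lambda>_. 0) (\<lambda>_. 0) c0 U = c0 * gh_z U"
  by (simp add: gh_psi_def)

lemma gh_omega_central:
  "gh_omega (gh_psi (\<lambda>_. 0) (\<lambda>_. 0) c0) U V
     = c0 * (gh_z U * gh_t V - gh_z V * gh_t U - gh_beta U V)"
  by (simp add: gh_omega_def wedge11_def ce_d1_def gh_psi_central algebra_simps)

lemma gh_metric_gh_J:
  fixes \<epsilon> :: "'m::finite \<Rightarrow> real"
  assumes c: "c \<noteq> 0"
  shows "gh_metric (gh_J c d \<epsilon>) (gh_psi (\<lambda>_. 0) (\<lambda>_. 0) c0) U V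
     = c0 * (c * gh_t U * gh_t V + gh_s d U * gh_s d V / c
             + (\<Sum>i\<in>UNIV. \<epsilon> i * (gh_x i U * gh_x i V + gh_y i U * gh_y i V)))"
proof -
  have "gh_beta (gh_J c d \<epsilon> U) V
      = - (\<Sum>i\<in>UNIV. \<epsilon> i * (gh_x i U * gh_x i V + gh_y i U * gh_y i V))"
    unfolding gh_beta_def sum_negf[symmetric]
    by (rule sum.cong) (simp_all add: algebra_simps)
  then show ?thesis
    using c by (simp add: gh_metric_def gh_omega_central) (simp add: gh_s_def field_simps)
qed

lemma gh_metric_sym:
  assumes "c \<noteq> 0"
  shows "gh_metric (gh_J c d \<epsilon>) (gh_psi (\<lambda>_. 0) (\<lambda>_. 0) c0) U V
       = gh_metric (gh_J c d \<epsilon>) (gh_psi (\<lambda>_. 0) (\<lambda>_. 0) c0) V U"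
  unfolding gh_metric_gh_J[OF assms] by (simp add: ac_simps)

text \<open>The basis is orthogonal up to replacing \<open>T\<close> by \<open>T - d Z\<close>, so pairing with a basis vector
  recovers one coordinate.\<close>

lemma gh_metric_T_minus_dZ: "c \<noteq> 0 \<Longrightarrow>
    gh_metric (gh_J c d \<epsilon>) (gh_psi (\<lambda>_. 0) (\<lambda>_. 0) c0) U (gh_T - d *\<^sub>R gh_Z) = c0 * c * gh_t U"
  and gh_metric_Z: "c \<noteq> 0 \<Longrightarrow>
    gh_metric (gh_J c d \<epsilon>) (gh_psi (\<lambda>_. 0) (\<lambda>_. 0) c0) U gh_Z = c0 * gh_s d U / c"
  and gh_metric_X: "c \<noteq> 0 \<Longrightarrow>
    gh_metric (gh_J c d \<epsilon>) (gh_psi (\<lambda>_. 0) (\<lambda>_. 0) c0) U (gh_X i) = c0 * \<epsilon> i * gh_x i U"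
  and gh_metric_Y: "c \<noteq> 0 \<Longrightarrow>
    gh_metric (gh_J c d \<epsilon>) (gh_psi (\<lambda>_. 0) (\<lambda>_. 0) c0) U (gh_Y i) = c0 * \<epsilon> i * gh_y i U"
  by (simp_all add: gh_metric_gh_J gh_s_def gh_T_def gh_X_def gh_Y_def gh_Z_def axis_def
      if_distrib[where f = "\<lambda>x. _ * x"] sum.delta' cong: if_cong)

lemma scalar_product_gh_metric:
  fixes \<epsilon> :: "'m::finite \<Rightarrow> real"
  assumes c: "c \<noteq> 0" and eps: "\<forall>i. \<epsilon> i \<in> {1, -1}" and c0: "c0 \<noteq> 0"
  shows "scalar_product (gh_metric (gh_J c d \<epsilon>) (gh_psi (\<lambda>_. 0) (\<lambda>_. 0) c0))"
    (is "scalar_product ?g")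
proof -
  have e: "\<epsilon> i \<noteq> 0" for i using spec[OF eps, of i] by auto
  have "bilinear ?g"
    unfolding bilinear_def
    by (intro conjI allI linearI)
      (simp_all add: gh_metric_gh_J[OF c] gh_coord_lin_simps algebra_simps sum.distrib
        sum_distrib_left add_divide_distrib)
  moreover have "?g U V = ?g V U" for U V
    by (rule gh_metric_sym[OF c])
  moreover have "U = 0" if "\<forall>V. ?g U V = 0" for U
  proof (rule gh_eqI)
    have "c0 * c * gh_t U = 0" using that gh_metric_T_minus_dZ[OF c, of d \<epsilon> c0 U] by metis
    then show t: "gh_t U = gh_t 0" using c c0 by (simp add: gh_coord_lin_simps)
    show "gh_x i U = gh_x i 0" for i
    proof -
      have "c0 * \<epsilon> i * gh_x i U = 0" using that gh_metric_X[OF c, of d \<epsilon> c0 U i] by metis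
      then show ?thesis using c0 e by (simp add: gh_coord_lin_simps)
    qed
    show "gh_y i U = gh_y i 0" for i
    proof -
      have "c0 * \<epsilon> i * gh_y i U = 0" using that gh_metric_Y[OF c, of d \<epsilon> c0 U i] by metis
      then show ?thesis using c0 e by (simp add: gh_coord_lin_simps)
    qed
    have "c0 * gh_s d U / c = 0" using that gh_metric_Z[OF c, of d \<epsilon> c0 U] by metis
    then have "gh_s d U = 0" using c c0 by simp
    then show "gh_z U = gh_z 0" using t by (simp add: gh_s_def gh_coord_lin_simps)
  qed
  ultimately show ?thesis unfolding scalar_product_def by blast
qed

lemma gh_fundamental_form:
  fixes \<epsilon> :: "'m::finite \<Rightarrow> real"
  assumes c: "c \<noteq> 0" and eps: "\<forall>i. \<epsilon> i \<in> {1, -1}"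
  shows "fundamental_form (gh_metric (gh_J c d \<epsilon>) (gh_psi (\<lambda>_. 0) (\<lambda>_. 0) c0)) (gh_J c d \<epsilon>)
     = gh_omega (gh_psi (\<lambda>_. 0) (\<lambda>_. 0) c0)" (is "fundamental_form ?g ?J = ?\<omega>")
proof (intro ext)
  fix U V
  have "?g U (?J V) = ?g (?J V) U"
    by (rule gh_metric_sym[OF c])
  also have "\<dots> = ?\<omega> (- V) U"
    by (simp add: gh_metric_def gh_J_square[OF c eps])
  also have "\<dots> = ?\<omega> U V"
    by (simp add: gh_omega_central gh_beta_def gh_coord_lin_simps algebra_simps sum_subtractf)
  finally show "fundamental_form ?g ?J U V = ?\<omega> U V"
    by (simp add: fundamental_form_def)
qed

lemma pseudo_hermitian_gh_metric:
  fixes \<epsilon> :: "'m::finite \<Rightarrow> real"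
  assumes c: "c \<noteq> 0" and eps: "\<forall>i. \<epsilon> i \<in> {1, -1}" and c0: "c0 \<noteq> 0"
  shows "pseudo_hermitian gh_bracket (gh_metric (gh_J c d \<epsilon>) (gh_psi (\<lambda>_. 0) (\<lambda>_. 0) c0))
           (gh_J c d \<epsilon>)" (is "pseudo_hermitian _ ?g ?J")
proof -
  have "?g (?J U) V = - ?g U (?J V)" for U V
    using fun_cong[OF fun_cong[OF gh_fundamental_form[OF c eps, of d c0]], of U V]
    by (simp add: fundamental_form_def)
      (simp add: gh_metric_def gh_J_square[OF c eps] gh_omega_central gh_beta_def
        gh_coord_lin_simps algebra_simps sum_subtractf)
  then show ?thesis
    by (simp add: pseudo_hermitian_def scalar_product_gh_metric[OF c eps c0]
        complex_structure_gh_J[OF c eps])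
qed

section \<open>The Lee form and the Levi-Civita connection\<close>

lemma lee_form_gh_t:
  fixes \<epsilon> :: "'m::finite \<Rightarrow> real"
  assumes c: "c \<noteq> 0" and eps: "\<forall>i. \<epsilon> i \<in> {1, -1}"
  shows "lee_form gh_bracket (gh_metric (gh_J c d \<epsilon>) (gh_psi (\<lambda>_. 0) (\<lambda>_. 0) c0))
           (gh_J c d \<epsilon>) gh_t"
proof -
  have beta0: "gh_beta (gh_bracket U V) W = 0" for U V W :: "'m gh"
    by (simp add: gh_beta_def)
  show ?thesis
    unfolding lee_form_def gh_fundamental_form[OF c eps]
    by (auto simp: fun_eq_iff gh_coord_linear ce_d1_def ce_d2_def wedge21_def gh_omega_central
        beta0 algebra_simps)
qed

text \<open>
  The Koszul formula gives \<open>2 \<nabla>\<^sub>U V = [U, V] - (c\<^sub>0 / c) (s(U) B V + s(V) B U)\<close>, where \<open>B\<close> is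
  determined by \<open>\<langle>B V, W\<rangle> = \<beta>(V, W)\<close>, that is, \<open>c\<^sub>0 B\<close> is \<open>J\<close> on the span of the \<open>X\<^sub>i, Y\<^sub>i\<close> and
  zero on \<open>T\<close> and \<open>Z\<close>. The factor \<open>c\<^sub>0\<close> cancels.
\<close>

definition gh_nabla :: "real \<Rightarrow> real \<Rightarrow> ('m::finite \<Rightarrow> real) \<Rightarrow> 'm gh \<Rightarrow> 'm gh \<Rightarrow> 'm gh" where
  "gh_nabla c d \<epsilon> U V =
     (0, (\<chi> i. \<epsilon> i * (gh_s d U * gh_y i V + gh_s d V * gh_y i U) / (2 * c)),
      (\<chi> i. - (\<epsilon> i * (gh_s d U * gh_x i V + gh_s d V * gh_x i U) / (2 * c))), gh_beta U V / 2)"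

lemma gh_nabla_coords [simp]:
  "gh_t (gh_nabla c d \<epsilon> U V) = 0"
  "gh_x i (gh_nabla c d \<epsilon> U V) = \<epsilon> i * (gh_s d U * gh_y i V + gh_s d V * gh_y i U) / (2 * c)"
  "gh_y i (gh_nabla c d \<epsilon> U V) = - (\<epsilon> i * (gh_s d U * gh_x i V + gh_s d V * gh_x i U) / (2 * c))"
  "gh_z (gh_nabla c d \<epsilon> U V) = gh_beta U V / 2"
  "gh_s d (gh_nabla c d \<epsilon> U V) = gh_beta U V / 2"
  by (simp_all add: gh_nabla_def gh_s_def)

lemma gh_beta_skew: "gh_beta V U = - gh_beta U V"
  by (simp add: gh_beta_def algebra_simps flip: sum_negf)

lemma gh_beta_linear: "linear (gh_beta U)"
  by (rule linearI)
    (simp_all add: gh_beta_def gh_coord_lin_simps algebra_simps sum.distrib sum_subtractf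
      sum_distrib_left)

lemma bilinear_gh_nabla: "bilinear (gh_nabla c d \<epsilon>)"
  unfolding bilinear_def
proof (intro conjI allI)
  show lin: "linear (gh_nabla c d \<epsilon> U)" for U
    by (rule linearI; rule gh_eqI)
      (simp_all add: gh_coord_lin_simps linear_add[OF gh_beta_linear]
        linear_cmul[OF gh_beta_linear] algebra_simps add_divide_distrib)
  show "linear (\<lambda>U. gh_nabla c d \<epsilon> U V)" for V
    by (rule linearI; rule gh_eqI)
      (simp_all add: gh_coord_lin_simps gh_beta_skew[of _ V] linear_add[OF gh_beta_linear]
        linear_cmul[OF gh_beta_linear] algebra_simps add_divide_distrib diff_divide_distrib)
qed

lemma levi_civita_gh_nabla:
  fixes \<epsilon> :: "'m::finite \<Rightarrow> real"
  assumes c: "c \<noteq> 0" and eps: "\<forall>i. \<epsilon> i \<in> {1, -1}"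
  shows "levi_civita gh_bracket (gh_metric (gh_J c d \<epsilon>) (gh_psi (\<lambda>_. 0) (\<lambda>_. 0) c0))
           (gh_nabla c d \<epsilon>)" (is "levi_civita _ ?g ?D")
proof -
  have "?D U V - ?D V U = gh_bracket U V" for U V
    by (rule gh_eqI) (simp_all add: gh_coord_lin_simps gh_beta_skew[of V U] algebra_simps)
  moreover have "?g (?D U V) W + ?g V (?D U W) = 0" for U V W
  proof -
    have e: "\<epsilon> i * (\<epsilon> i * r) = r" for i r using spec[OF eps, of i] by auto
    have horizontal: "(\<Sum>i\<in>UNIV. \<epsilon> i * (gh_x i (?D U V) * gh_x i W + gh_y i (?D U V) * gh_y i W))
        = - (gh_s d U * gh_beta V W + gh_s d V * gh_beta U W) / (2 * c)" for V W
      by (simp add: gh_beta_def sum_distrib_left sum_divide_distrib add_divide_distrib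
          diff_divide_distrib algebra_simps e flip: sum_negf sum.distrib)
    have horizontal': "(\<Sum>i\<in>UNIV. \<epsilon> i * (gh_x i V * gh_x i (?D U W) + gh_y i V * gh_y i (?D U W)))
        = - (gh_s d U * gh_beta W V + gh_s d W * gh_beta U V) / (2 * c)"
      using horizontal[of W V] by (simp only: mult.commute[of "gh_x _ V"] mult.commute[of "gh_y _ V"])
    show ?thesis
      unfolding gh_metric_gh_J[OF c] horizontal horizontal'
      using c by (simp add: gh_beta_skew[of W V] field_simps)
  qed
  ultimately show ?thesis
    by (simp add: levi_civita_def bilinear_gh_nabla)
qed

lemma vaisman_gh_metric:
  fixes \<epsilon> :: "'m::finite \<Rightarrow> real"
  assumes "c \<noteq> 0" and "\<forall>i. \<epsilon> i \<in> {1, -1}" and "c0 \<noteq> 0"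
  shows "vaisman gh_bracket (gh_metric (gh_J c d \<epsilon>) (gh_psi (\<lambda>_. 0) (\<lambda>_. 0) c0)) (gh_J c d \<epsilon>)"
proof -
  have "cov_deriv_form (gh_nabla c d \<epsilon>) gh_t U V = 0" for U V
    by (simp add: cov_deriv_form_def)
  then show ?thesis
    unfolding vaisman_def loc_conf_pseudo_kaehler_def
    using pseudo_hermitian_gh_metric[OF assms] lee_form_gh_t[OF assms(1,2)]
      levi_civita_gh_nabla[OF assms(1,2)] by blast
qed

section \<open>Definiteness and the classification\<close>

lemma positive_definite_gh_metric_iff:
  fixes \<epsilon> :: "'m::finite \<Rightarrow> real"
  assumes c: "c \<noteq> 0" and eps: "\<forall>i. \<epsilon> i \<in> {1, -1}"
  shows "positive_definite (gh_metric (gh_J c d \<epsilon>) (gh_psi (\<lambda>_. 0) (\<lambda>_. 0) c0)) \<longleftrightarrow>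
           c * c0 > 0 \<and> (\<forall>i. sgn c0 * \<epsilon> i = 1)" (is "positive_definite ?g \<longleftrightarrow> _")
proof
  assume pos: "positive_definite ?g"
  then have pos: "U \<noteq> 0 \<Longrightarrow> 0 < ?g U U" for U
    unfolding positive_definite_def by blast
  have "gh_T - d *\<^sub>R gh_Z \<noteq> (0 :: 'm gh)" by (simp add: gh_defs zero_prod_def)
  from pos[OF this] have "c * c0 > 0"
    by (simp add: gh_metric_T_minus_dZ[OF c]) (simp add: gh_defs mult.commute)
  moreover have "sgn c0 * \<epsilon> i = 1" for i
  proof -
    have "gh_X i \<noteq> (0 :: 'm gh)" by (simp add: gh_defs zero_prod_def axis_eq_0_iff)
    from pos[OF this] have "c0 * \<epsilon> i > 0"
      by (simp add: gh_metric_X[OF c]) (simp add: gh_defs)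
    then show ?thesis using spec[OF eps, of i] by (auto simp: sgn_real_def)
  qed
  ultimately show "c * c0 > 0 \<and> (\<forall>i. sgn c0 * \<epsilon> i = 1)" by blast
next
  assume A: "c * c0 > 0 \<and> (\<forall>i. sgn c0 * \<epsilon> i = 1)"
  then have c0: "c0 \<noteq> 0" by auto
  have c0_eps: "c0 * \<epsilon> i = \<bar>c0\<bar>" for i
    using A by (metis abs_mult_sgn mult.assoc mult.right_neutral)
  have cc: "c0 / c > 0" using A by (auto simp: zero_less_mult_iff zero_less_divide_iff)
  have expand: "?g U U = c * c0 * (gh_t U)\<^sup>2 + c0 / c * (gh_s d U)\<^sup>2
      + (\<Sum>i\<in>UNIV. \<bar>c0\<bar> * ((gh_x i U)\<^sup>2 + (gh_y i U)\<^sup>2))" for U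
  proof -
    have "c0 * (\<Sum>i\<in>UNIV. \<epsilon> i * (gh_x i U * gh_x i U + gh_y i U * gh_y i U))
        = (\<Sum>i\<in>UNIV. \<bar>c0\<bar> * ((gh_x i U)\<^sup>2 + (gh_y i U)\<^sup>2))"
      by (simp only: sum_distrib_left mult.assoc[symmetric] c0_eps power2_eq_square)
    then show ?thesis
      by (simp add: gh_metric_gh_J[OF c] distrib_left power2_eq_square)
  qed
  have t: "c * c0 * r\<^sup>2 \<ge> 0" and s: "c0 / c * r\<^sup>2 \<ge> 0" for r :: real
    using A cc by (simp_all del: times_divide_eq_left)
  have nonneg: "?g U U \<ge> 0" for U
    unfolding expand by (intro add_nonneg_nonneg t s sum_nonneg mult_nonneg_nonneg) auto
  have "U = 0" if "?g U U = 0" for U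
  proof -
    let ?S = "\<Sum>i\<in>UNIV. \<bar>c0\<bar> * ((gh_x i U)\<^sup>2 + (gh_y i U)\<^sup>2)"
    have "?S \<ge> 0" by (intro sum_nonneg) auto
    then have "c * c0 * (gh_t U)\<^sup>2 = 0" "c0 / c * (gh_s d U)\<^sup>2 = 0" and S: "?S = 0"
      using that t[of "gh_t U"] s[of "gh_s d U"] unfolding expand by linarith+
    then have tU: "gh_t U = 0" and sU: "gh_s d U = 0" using c c0 by auto
    have "\<bar>c0\<bar> * ((gh_x i U)\<^sup>2 + (gh_y i U)\<^sup>2) = 0" for i
      using S by (subst (asm) sum_nonneg_eq_0_iff) auto
    then have "gh_x i U = 0" "gh_y i U = 0" for i
      using c0 by (simp_all add: sum_power2_eq_zero_iff)
    then show ?thesis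
      using tU sU by (intro gh_eqI) (simp_all add: gh_coord_lin_simps gh_s_def)
  qed
  then show "positive_definite ?g"
    using nonneg unfolding positive_definite_def by (metis less_eq_real_def)
qed

lemma loc_conf_pseudo_kaehler_gh_iff:
  fixes a b \<epsilon> :: "'m::finite \<Rightarrow> real"
  assumes c: "c \<noteq> 0" and eps: "\<forall>i. \<epsilon> i \<in> {1, -1}"
  shows "loc_conf_pseudo_kaehler gh_bracket (gh_metric (gh_J c d \<epsilon>) (gh_psi a b c0)) (gh_J c d \<epsilon>)
     \<longleftrightarrow> c0 \<noteq> 0 \<and> a = (\<lambda>_. 0) \<and> b = (\<lambda>_. 0)"
proof
  let ?g = "gh_metric (gh_J c d \<epsilon>) (gh_psi a b c0)"
  assume "loc_conf_pseudo_kaehler gh_bracket ?g (gh_J c d \<epsilon>)"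
  then have sym: "?g U V = ?g V U" and nondeg: "(\<And>V. ?g U V = 0) \<Longrightarrow> U = 0" for U V
    unfolding loc_conf_pseudo_kaehler_def pseudo_hermitian_def scalar_product_def by blast+
  have ab: "a = (\<lambda>_. 0)" "b = (\<lambda>_. 0)"
    using gh_metric_symmetric_imp_zero[OF c sym] by (simp_all add: fun_eq_iff)
  have "c0 \<noteq> 0"
  proof
    assume "c0 = 0"
    then have "gh_T = (0 :: 'm gh)"
      by (intro nondeg) (simp add: ab gh_metric_gh_J[OF c])
    then show False by (simp add: gh_T_def zero_prod_def)
  qed
  with ab show "c0 \<noteq> 0 \<and> a = (\<lambda>_. 0) \<and> b = (\<lambda>_. 0)" by blast
next
  assume "c0 \<noteq> 0 \<and> a = (\<lambda>_. 0) \<and> b = (\<lambda>_. 0)"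
  then show "loc_conf_pseudo_kaehler gh_bracket (gh_metric (gh_J c d \<epsilon>) (gh_psi a b c0))
      (gh_J c d \<epsilon>)"
    using vaisman_gh_metric[OF c eps] by (simp add: vaisman_def)
qed

theorem proposition4:
  fixes c d c0 :: real
    and \<epsilon> a b :: "'m::finite \<Rightarrow> real"
    and J :: "'m gh \<Rightarrow> 'm gh"
  assumes "c \<noteq> 0"
    and "\<And>i. \<epsilon> i \<in> {1, -1}"
    and "linear J"
    and "J (gh_T - d *\<^sub>R gh_Z) = c *\<^sub>R gh_Z"
    and "J (c *\<^sub>R gh_Z) = - (gh_T - d *\<^sub>R gh_Z)"
    and "\<And>i. J (gh_X i) = \<epsilon> i *\<^sub>R gh_Y i"
    and "\<And>i. J (gh_Y i) = - (\<epsilon> i *\<^sub>R gh_X i)"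
  shows "(loc_conf_kaehler gh_bracket (gh_metric J (gh_psi a b c0)) J \<longleftrightarrow>
            c * c0 > 0 \<and> (\<forall>i. a i = 0 \<and> b i = 0 \<and> sgn c0 * \<epsilon> i = 1)) \<and>
         (loc_conf_kaehler gh_bracket (gh_metric J (gh_psi a b c0)) J \<longrightarrow>
            vaisman gh_bracket (gh_metric J (gh_psi a b c0)) J) \<and>
         (loc_conf_pseudo_kaehler gh_bracket (gh_metric J (gh_psi a b c0)) J \<longleftrightarrow>
            c0 \<noteq> 0 \<and> (\<forall>i. a i = 0 \<and> b i = 0)) \<and>
         (loc_conf_pseudo_kaehler gh_bracket (gh_metric J (gh_psi a b c0)) J \<longrightarrow>
            vaisman gh_bracket (gh_metric J (gh_psi a b c0)) J)"
proof -
  have eps: "\<forall>i. \<epsilon> i \<in> {1, -1}" using assms(2) by blast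
  have J: "J = gh_J c d \<epsilon>" using assms by (intro gh_J_unique)
  let ?g = "gh_metric J (gh_psi a b c0)"
  have pseudo: "loc_conf_pseudo_kaehler gh_bracket ?g J \<longleftrightarrow> c0 \<noteq> 0 \<and> a = (\<lambda>_. 0) \<and> b = (\<lambda>_. 0)"
    unfolding J by (rule loc_conf_pseudo_kaehler_gh_iff[OF assms(1) eps])
  have vaisman: "vaisman gh_bracket ?g J" if "loc_conf_pseudo_kaehler gh_bracket ?g J"
  proof -
    from that have "c0 \<noteq> 0" and ab: "a = (\<lambda>_. 0)" "b = (\<lambda>_. 0)" using pseudo by simp_all
    then show ?thesis unfolding J ab by (intro vaisman_gh_metric[OF assms(1) eps])
  qed
  have pos: "positive_definite ?g \<longleftrightarrow> c * c0 > 0 \<and> (\<forall>i. sgn c0 * \<epsilon> i = 1)"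
    if "a = (\<lambda>_. 0)" "b = (\<lambda>_. 0)"
    unfolding J that by (rule positive_definite_gh_metric_iff[OF assms(1) eps])
  have "c0 \<noteq> 0" if "c * c0 > 0" using that by auto
  then have kaehler: "loc_conf_kaehler gh_bracket ?g J \<longleftrightarrow>
      c * c0 > 0 \<and> (\<forall>i. sgn c0 * \<epsilon> i = 1) \<and> a = (\<lambda>_. 0) \<and> b = (\<lambda>_. 0)"
    unfolding loc_conf_kaehler_def pseudo using pos by blast
  have vaisman': "vaisman gh_bracket ?g J" if "loc_conf_kaehler gh_bracket ?g J"
    using that vaisman unfolding loc_conf_kaehler_def by blast
  have iff1: "c0 \<noteq> 0 \<and> a = (\<lambda>_. 0) \<and> b = (\<lambda>_. 0) \<longleftrightarrow> c0 \<noteq> 0 \<and> (\<forall>i. a i = 0 \<and> b i = 0)"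
    and iff2: "c * c0 > 0 \<and> (\<forall>i. sgn c0 * \<epsilon> i = 1) \<and> a = (\<lambda>_. 0) \<and> b = (\<lambda>_. 0) \<longleftrightarrow>
      c * c0 > 0 \<and> (\<forall>i. a i = 0 \<and> b i = 0 \<and> sgn c0 * \<epsilon> i = 1)"
    unfolding fun_eq_iff by blast+
  show ?thesis
    by (intro conjI impI trans[OF kaehler iff2] trans[OF pseudo iff1] vaisman' vaisman)
qed

end
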